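(* The following hold: (i) $\mu(1) = 1$; (ii) $\mu(2) = 2$; (iii) $\mu(3) = \mu(4) = \mu(5) = 3$.
   Context: $\mathbb{N}$ denotes the set of positive integers. Fix an infinite set $D_0$ and recursively let $D_{n+1}$ be the set of finite non-empty subsets of $D_n$, for $n \geq 0$. For $k \geq 1$ and $n \geq 0$, define a set $\mathcal{F}^{(k)}_n$ of functions $D_0^k \to D_n$ by recursion on $n$: $\mathcal{F}^{(k)}_0$ is the set of the $k$ projections $(x_1,\dots,x_k) \mapsto x_i$ ($1 \leq i \leq k$); and $\mathcal{F}^{(k)}_{n+1}$ is the set of those functions $D_0^k \to D_{n+1}$ of the form $\mathbf{x} \mapsto \{g(\mathbf{x}) : g \in \mathcal{G}\}$ for some non-empty $\mathcal{G} \subseteq \mathcal{F}^{(k)}_n$. A pair $(k,n) \in \mathbb{N} \times \mathbb{N}$ is called good if $\mathcal{F}^{(k)}_n$ contains an injective function. For $k \in \mathbb{N}$, $\mu(k)$ is the least $n \in \mathbb{N}$ such that $(k,n)$ is good (for every $k \in \mathbb{N}$ such an $n$ exists, so $\mu$ is well-defined). *)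

theory Defs
  imports "HOL-Library.FSet" "HOL-Library.FuncSet"
begin

text \<open>
  Since \<open>D\<^sub>n\<close> lives at a different type for each \<open>n\<close>, all levels are embedded in one type:
  hereditarily finite sets over a type of atoms. Atoms are kept apart from sets, which loses nothing,
  because only equality within a single level \<open>D\<^sub>n\<close> matters and this is determined
  by extensionality.
\<close>

datatype 'a hset = Atom 'a | HSet "'a hset fset"

primrec elts :: "'a hset \<Rightarrow> 'a hset set" where
  "elts (Atom a) = {}"
| "elts (HSet S) = fset S"

primrec lev :: "'a set \<Rightarrow> nat \<Rightarrow> 'a hset set" where
  "lev D0 0 = Atom ` D0"
| "lev D0 (Suc n) = {HSet S |S. fset S \<noteq> {} \<and> fset S \<subseteq> lev D0 n}"

definition tuples :: "'a set \<Rightarrow> nat \<Rightarrow> (nat \<Rightarrow> 'a) set" where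
  "tuples D0 k = {1..k} \<rightarrow>\<^sub>E D0"

text \<open>
  Functions on \<open>D\<^sub>0\<^sup>k\<close> are total HOL functions that are \<^const>\<open>undefined\<close> off
  \<^term>\<open>tuples D0 k\<close>, so that HOL equality is equality of functions on \<open>D\<^sub>0\<^sup>k\<close>.
\<close>

primrec FF :: "'a set \<Rightarrow> nat \<Rightarrow> nat \<Rightarrow> ((nat \<Rightarrow> 'a) \<Rightarrow> 'a hset) set" where
  "FF D0 k 0 = {\<lambda>x\<in>tuples D0 k. Atom (x i) |i. i \<in> {1..k}}"
| "FF D0 k (Suc n) = {f \<in> tuples D0 k \<rightarrow>\<^sub>E lev D0 (Suc n).
     \<exists>G. G \<noteq> {} \<and> G \<subseteq> FF D0 k n \<and> (\<forall>x\<in>tuples D0 k. elts (f x) = {g x |g. g \<in> G})}"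

definition good :: "'a set \<Rightarrow> nat \<Rightarrow> nat \<Rightarrow> bool" where
  "good D0 k n \<longleftrightarrow> 1 \<le> k \<and> 1 \<le> n \<and> (\<exists>f\<in>FF D0 k n. inj_on f (tuples D0 k))"

definition mu :: "'a set \<Rightarrow> nat \<Rightarrow> nat" where
  "mu D0 k = (LEAST n. good D0 k n)"

lemma FF_funcset: "FF D0 k n \<subseteq> tuples D0 k \<rightarrow>\<^sub>E lev D0 n"
proof (cases n)
  case 0
  have "x i \<in> D0" if "x \<in> tuples D0 k" "i \<in> {1..k}" for x i
    using that unfolding tuples_def by (rule PiE_mem)
  with 0 show ?thesis by (auto simp: PiE_iff extensional_def)
next
  case (Suc m)
  thus ?thesis by (simp del: lev.simps)
qed

lemma elts_inject_lev:
  assumes "u \<in> lev D0 (Suc n)" "v \<in> lev D0 (Suc n)" "elts u = elts v"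
  shows "u = v"
  using assms by (auto simp: fset_inject)

lemma finite_FF: "finite (FF D0 k n)"
proof (induction n)
  case 0
  show ?case by simp
next
  case (Suc n)
  let ?T = "tuples D0 k"
  define P where "P f G \<longleftrightarrow> G \<noteq> {} \<and> G \<subseteq> FF D0 k n \<and> (\<forall>x\<in>?T. elts (f x) = {g x |g. g \<in> G})"
    for f :: "(nat \<Rightarrow> 'a) \<Rightarrow> 'a hset" and G
  define h where "h f = (SOME G. P f G)" for f
  have h: "P f (h f)" if "f \<in> FF D0 k (Suc n)" for f
  proof -
    have "\<exists>G. P f G"
      using that unfolding FF.simps(2) P_def by blast
    thus ?thesis
      unfolding h_def by (rule someI_ex)
  qed
  have "inj_on h (FF D0 k (Suc n))"
  proof (rule inj_onI)
    fix f f' assume f: "f \<in> FF D0 k (Suc n)" "f' \<in> FF D0 k (Suc n)" and eq: "h f = h f'"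
    have ff: "f \<in> ?T \<rightarrow>\<^sub>E lev D0 (Suc n)" "f' \<in> ?T \<rightarrow>\<^sub>E lev D0 (Suc n)"
      using f FF_funcset by blast+
    show "f = f'"
    proof (rule PiE_ext[OF ff])
      fix x assume x: "x \<in> ?T"
      have "elts (f x) = elts (f' x)"
        using h[OF f(1)] h[OF f(2)] eq x unfolding P_def by simp
      thus "f x = f' x"
        by (rule elts_inject_lev[OF PiE_mem[OF ff(1) x] PiE_mem[OF ff(2) x]])
    qed
  qed
  moreover have "h ` FF D0 k (Suc n) \<subseteq> Pow (FF D0 k n)"
    using h unfolding P_def by blast
  ultimately show ?case
    using Suc.IH by (meson finite_Pow_iff finite_imageD finite_subset)
qed

text \<open>Every non-empty \<open>G\<close> does give rise to a member of the next level.\<close>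

lemma FF_SucI:
  assumes "G \<noteq> {}" "G \<subseteq> FF D0 k n"
  shows "(\<lambda>x\<in>tuples D0 k. HSet (Abs_fset {g x |g. g \<in> G})) \<in> FF D0 k (Suc n)"
proof -
  have "finite G"
    using assms(2) finite_FF finite_subset by blast
  hence fin: "finite {g x |g. g \<in> G}" for x
    by simp
  have "g x \<in> lev D0 n" if "g \<in> G" "x \<in> tuples D0 k" for g x
    using assms(2) FF_funcset that by (blast dest: PiE_mem)
  hence "HSet (Abs_fset {g x |g. g \<in> G}) \<in> lev D0 (Suc n)" if "x \<in> tuples D0 k" for x
    using assms(1) that fin[of x] by (fastforce simp: Abs_fset_inverse)
  moreover have "elts (HSet (Abs_fset {g x |g. g \<in> G})) = {g x |g. g \<in> G}" for x
    using fin[of x] by (simp add: Abs_fset_inverse)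
  ultimately show ?thesis
    using assms by (simp del: lev.simps elts.simps) blast
qed

end

theory Submission
  imports Defs
begin

text \<open>
  Lower bounds. Fix two atoms. A function in \<open>\<F>\<^sub>n\<close> only forms sets out of its arguments, so it maps
  tuples over these two atoms to objects of level \<open>n\<close> over the same two atoms
  (\<open>FF_lev_subset\<close>). There are \<open>2\<^sup>k\<close> such tuples, but only \<open>2\<^sup>2 - 1 = 3\<close> objects of level 1 and
  \<open>2\<^sup>3 - 1 = 7\<close> of level 2. An injective function therefore needs level at least 2 for
  \<open>k = 2\<close> and level at least 3 for \<open>k \<ge> 3\<close>.

  Upper bounds. For \<open>k = 1\<close> the singleton \<open>{x\<^sub>1}\<close> is enough, and for \<open>k = 2\<close> the Kuratowski pair
  \<open>{{x\<^sub>1}, {x\<^sub>1, x\<^sub>2}}\<close>. For \<open>k = 5\<close> level 3 is reached by the code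
  \<open>{ {{a}}, {{a, b}}, {{c}, {d, e}}, {{d}, {a, e}, {a, d, e}} }\<close>,
  which determines its five arguments one after the other (\<open>quint_inject\<close>). The first two members
  act as a Kuratowski pair one level up and give \<open>a\<close> and \<open>b\<close>; the last one gives \<open>d\<close> and \<open>e\<close> once
  \<open>a\<close> is known; the third then gives \<open>c\<close>. The difficulty is that the members do not come labelled and may
  coincide or shrink when arguments are equal. Each such accident forces so many
  equalities between the arguments that the decoding still succeeds. Repeating the last
  argument turns the same code into one for \<open>k = 3\<close> and \<open>k = 4\<close>.
\<close>

section \<open>Functions from index patterns\<close>

lemma FF_0_proj:
  assumes "i \<in> {1..k}"
  obtains g where "g \<in> FF D0 k 0" "\<And>x. x \<in> tuples D0 k \<Longrightarrow> g x = Atom (x i)"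
proof
  show "(\<lambda>x\<in>tuples D0 k. Atom (x i)) \<in> FF D0 k 0"
    using assms by auto
qed simp

text \<open>
  The recursion step of \<^const>\<open>FF\<close> in a form that can be iterated. The function \<open>P\<close> reads off from an
  object of level \<open>n\<close> a plain HOL value; then \<open>\<lambda>u. P ` elts u\<close> does this one level higher. In this way
  a function is described by a nested set of indices and its value is the image of that
  pattern under the tuple.
\<close>

lemma FF_Suc_realize:
  assumes "I \<noteq> {}"
    and "\<And>i. i \<in> I \<Longrightarrow> \<exists>g\<in>FF D0 k n. \<forall>x\<in>tuples D0 k. P (g x) = h i x"
  shows "\<exists>f\<in>FF D0 k (Suc n). \<forall>x\<in>tuples D0 k. P ` elts (f x) = (\<lambda>i. h i x) ` I"
proof -
  obtain g where g: "\<And>i. i \<in> I \<Longrightarrow> g i \<in> FF D0 k n"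
      "\<And>i x. i \<in> I \<Longrightarrow> x \<in> tuples D0 k \<Longrightarrow> P (g i x) = h i x"
    using assms(2) by metis
  let ?f = "\<lambda>x\<in>tuples D0 k. HSet (Abs_fset {u x |u. u \<in> g ` I})"
  have sub: "g ` I \<subseteq> FF D0 k n"
    using g(1) by blast
  hence "finite (g ` I)"
    using finite_FF finite_subset by blast
  hence fin: "finite {u x |u. u \<in> g ` I}" for x
    by simp
  have "P ` elts (?f x) = (\<lambda>i. h i x) ` I" if x: "x \<in> tuples D0 k" for x
  proof -
    have "elts (?f x) = (\<lambda>i. g i x) ` I"
      using x fin[of x] by (auto simp: Abs_fset_inverse)
    thus ?thesis
      using g(2) x by (simp add: image_image)
  qed
  moreover have "?f \<in> FF D0 k (Suc n)"
    using assms(1) sub by (intro FF_SucI) auto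
  ultimately show ?thesis by blast
qed

primrec unatom :: "'a hset \<Rightarrow> 'a" where
  "unatom (Atom a) = a"

text \<open>
  These maps erase the constructors, so that equalities of codes can be decided in ordinary set theory.
  Each is meant for objects of its own level, where \<^const>\<open>unatom\<close> only meets atoms.
\<close>

definition sets1 :: "'a hset \<Rightarrow> 'a set" where
  "sets1 u = unatom ` elts u"

definition sets2 :: "'a hset \<Rightarrow> 'a set set" where
  "sets2 u = sets1 ` elts u"

definition sets3 :: "'a hset \<Rightarrow> 'a set set set" where
  "sets3 u = sets2 ` elts u"

lemma FF_1_realize:
  assumes "A \<noteq> {}" "A \<subseteq> {1..k}"
  shows "\<exists>f\<in>FF D0 k 1. \<forall>x\<in>tuples D0 k. sets1 (f x) = x ` A"
  unfolding sets1_def One_nat_def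
proof (rule FF_Suc_realize[OF assms(1)])
  fix i assume "i \<in> A"
  with assms(2) have "i \<in> {1..k}" by blast
  then obtain g where "g \<in> FF D0 k 0" "\<And>x. x \<in> tuples D0 k \<Longrightarrow> g x = Atom (x i)"
    by (rule FF_0_proj) blast
  thus "\<exists>g\<in>FF D0 k 0. \<forall>x\<in>tuples D0 k. unatom (g x) = x i"
    by force
qed

lemma FF_2_realize:
  assumes "\<A> \<noteq> {}" "\<And>A. A \<in> \<A> \<Longrightarrow> A \<noteq> {} \<and> A \<subseteq> {1..k}"
  shows "\<exists>f\<in>FF D0 k 2. \<forall>x\<in>tuples D0 k. sets2 (f x) = (`) x ` \<A>"
  unfolding sets2_def numeral_2_eq_2
proof (rule FF_Suc_realize[OF assms(1)])
  fix A assume "A \<in> \<A>"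
  hence "A \<noteq> {}" "A \<subseteq> {1..k}"
    using assms(2) by blast+
  from FF_1_realize[OF this]
  show "\<exists>g\<in>FF D0 k (Suc 0). \<forall>x\<in>tuples D0 k. sets1 (g x) = x ` A"
    by (simp only: One_nat_def)
qed

lemma FF_3_realize:
  assumes "\<G> \<noteq> {}" "\<And>\<A>. \<A> \<in> \<G> \<Longrightarrow> \<A> \<noteq> {} \<and> (\<forall>A\<in>\<A>. A \<noteq> {} \<and> A \<subseteq> {1..k})"
  shows "\<exists>f\<in>FF D0 k 3. \<forall>x\<in>tuples D0 k. sets3 (f x) = (`) ((`) x) ` \<G>"
  unfolding sets3_def numeral_3_eq_3
proof (rule FF_Suc_realize[OF assms(1)])
  fix \<A> assume "\<A> \<in> \<G>"
  hence "\<A> \<noteq> {}" "\<And>A. A \<in> \<A> \<Longrightarrow> A \<noteq> {} \<and> A \<subseteq> {1..k}"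
    using assms(2) by blast+
  thus "\<exists>g\<in>FF D0 k (Suc (Suc 0)). \<forall>x\<in>tuples D0 k. sets2 (g x) = (`) x ` \<A>"
    by (rule FF_2_realize[unfolded numeral_2_eq_2])
qed

lemma tuples_eqI:
  assumes x: "x \<in> tuples D0 k" and y: "y \<in> tuples D0 k"
    and eq: "\<And>i. 1 \<le> i \<Longrightarrow> i \<le> k \<Longrightarrow> x i = y i"
  shows "x = y"
proof (rule PiE_ext[OF x[unfolded tuples_def] y[unfolded tuples_def]])
  fix i assume "i \<in> {1..k}"
  thus "x i = y i"
    by (intro eq) simp_all
qed

lemma goodI:
  assumes "1 \<le> k" "1 \<le> n" "f \<in> FF D0 k n"
    and "\<And>x y i. \<lbrakk>x \<in> tuples D0 k; y \<in> tuples D0 k; f x = f y; 1 \<le> i; i \<le> k\<rbrakk> \<Longrightarrow> x i = y i"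
  shows "good D0 k n"
  unfolding good_def
proof (intro conjI bexI)
  show "inj_on f (tuples D0 k)"
  proof (rule inj_onI)
    fix x y assume xy: "x \<in> tuples D0 k" "y \<in> tuples D0 k" "f x = f y"
    show "x = y"
      using xy(1,2) assms(4)[OF xy] by (rule tuples_eqI)
  qed
qed (use assms(1-3) in auto)

section \<open>Lower bound by counting values over two atoms\<close>

lemma tuples_mono: "D \<subseteq> D0 \<Longrightarrow> tuples D k \<subseteq> tuples D0 k"
  unfolding tuples_def by (rule PiE_mono)

text \<open>
  The members of \<open>FF D0 k n\<close> do not depend on \<open>D0\<close> except through their domain: only entries of the
  argument can occur in a value.
\<close>

lemma FF_lev_subset:
  assumes "D \<subseteq> D0"
  shows "f \<in> FF D0 k n \<Longrightarrow> x \<in> tuples D k \<Longrightarrow> f x \<in> lev D n"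
proof (induction n arbitrary: f)
  case 0
  have x: "x \<in> tuples D0 k"
    using tuples_mono[OF assms] 0(2) by (rule subsetD)
  obtain i where i: "i \<in> {1..k}" "f = (\<lambda>x\<in>tuples D0 k. Atom (x i))"
    using 0(1) unfolding FF.simps(1) mem_Collect_eq by (elim conjE exE) rule
  have "x i \<in> D"
    using 0(2) i(1) unfolding tuples_def by (rule PiE_mem)
  with x i(2) show ?case by simp
next
  case (Suc n)
  have x: "x \<in> tuples D0 k"
    using tuples_mono[OF assms] Suc.prems(2) by (rule subsetD)
  obtain G where G: "G \<subseteq> FF D0 k n" "\<forall>x\<in>tuples D0 k. elts (f x) = {g x |g. g \<in> G}"
    using Suc.prems(1) unfolding FF.simps(2) mem_Collect_eq by (elim conjE exE) rule
  have "f \<in> tuples D0 k \<rightarrow>\<^sub>E lev D0 (Suc n)"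
    using FF_funcset Suc.prems(1) by (rule subsetD)
  hence "f x \<in> lev D0 (Suc n)"
    using x by (rule PiE_mem)
  then obtain S where S: "f x = HSet S" "fset S \<noteq> {}"
    by auto
  have "fset S = {g x |g. g \<in> G}"
    using bspec[OF G(2) x] S(1) by simp
  moreover have "g x \<in> lev D n" if "g \<in> G" for g
    using Suc.IH[of g] G(1) that Suc.prems(2) by blast
  ultimately have "fset S \<subseteq> lev D n"
    by auto
  with S show ?case by simp
qed

text \<open>
  Objects of level \<open>n + 1\<close> are the same thing as non-empty sets of objects of level \<open>n\<close>. Finiteness and
  cardinality are proved together because the correspondence reaches every set only if the level below is
  finite.
\<close>

lemma finite_lev: "finite D \<Longrightarrow> finite (lev D n)"
  and card_lev_Suc: "finite D \<Longrightarrow> card (lev D (Suc n)) = 2 ^ card (lev D n) - 1"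
proof -
  assume D: "finite D"
  have bij: "bij_betw elts (lev D (Suc n)) (Pow (lev D n) - {{}})" if "finite (lev D n)" for n
  proof (rule bij_betw_imageI)
    show "inj_on elts (lev D (Suc n))"
      by (rule inj_onI) (rule elts_inject_lev)
    show "elts ` lev D (Suc n) = Pow (lev D n) - {{}}"
    proof (intro equalityI subsetI)
      fix A assume A: "A \<in> Pow (lev D n) - {{}}"
      hence "finite A" using that finite_subset by blast
      with A have "HSet (Abs_fset A) \<in> lev D (Suc n)" "A = elts (HSet (Abs_fset A))"
        by (auto simp: Abs_fset_inverse)
      thus "A \<in> elts ` lev D (Suc n)" by blast
    qed auto
  qed
  show fin: "finite (lev D n)" for n
  proof (induction n)
    case (Suc n)
    thus ?case using bij_betw_finite[OF bij[OF Suc]] by blast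
  qed (use D in simp)
  show "card (lev D (Suc n)) = 2 ^ card (lev D n) - 1"
    using bij_betw_same_card[OF bij[OF fin]] fin by (simp add: card_Diff_subset card_Pow)
qed

lemma good_card_bound:
  assumes "good D0 k n" "D \<subseteq> D0" "finite D"
  shows "card D ^ k \<le> card (lev D n)"
proof -
  obtain f where f: "f \<in> FF D0 k n" "inj_on f (tuples D0 k)"
    using assms(1) unfolding good_def by blast
  have "inj_on f (tuples D k)"
    using f(2) tuples_mono[OF assms(2)] by (rule inj_on_subset)
  moreover have "f ` tuples D k \<subseteq> lev D n"
    using FF_lev_subset[OF assms(2) f(1)] by blast
  ultimately have "card (tuples D k) \<le> card (lev D n)"
    using finite_lev[OF assms(3)] card_inj_on_le by blast
  thus ?thesis
    by (simp add: tuples_def card_PiE)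
qed

text \<open>
  Two atoms are the right number: one atom gives only one tuple, and already three atoms have 127
  objects of level 2, far more than the 27 triples.
\<close>

lemma good_two_atoms_bounds:
  assumes "infinite D0"
  shows "good D0 k 1 \<Longrightarrow> 2 ^ k \<le> (3::nat)" "good D0 k 2 \<Longrightarrow> 2 ^ k \<le> (7::nat)"
proof -
  obtain D where D: "D \<subseteq> D0" "finite D" "card D = 2"
    using infinite_arbitrarily_large[OF assms] by metis
  have c0: "card (lev D 0) = 2"
    using D(3) by (simp add: card_image inj_on_def)
  hence c1: "card (lev D 1) = 3"
    using card_lev_Suc[OF D(2), of 0] by simp
  hence "card (lev D 2) = 7"
    using card_lev_Suc[OF D(2), of 1] unfolding Suc_1 by simp
  with c1 show "good D0 k 1 \<Longrightarrow> 2 ^ k \<le> (3::nat)" "good D0 k 2 \<Longrightarrow> 2 ^ k \<le> (7::nat)"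
    using good_card_bound[OF _ D(1,2), of k 1] good_card_bound[OF _ D(1,2), of k 2] D(3)
    by (simp_all del: lev.simps One_nat_def)
qed

section \<open>Decoding a quintuple\<close>

text \<open>
  The pair \<open>(d, e)\<close> as seen from a known element \<open>a\<close>. The three sets are arranged so that the family
  determines \<open>d\<close> and \<open>e\<close> even if \<open>a\<close>, \<open>d\<close>, \<open>e\<close> are not distinct: for \<open>t \<noteq> a\<close>, the pairs
  \<open>(a, t)\<close>, \<open>(t, t)\<close> and \<open>(t, a)\<close> give \<open>{{a}, {a, t}}\<close>, \<open>{{t}, {a, t}}\<close> and
  \<open>{{t}, {a}, {a, t}}\<close>.
\<close>

definition linked :: "'a \<Rightarrow> 'a \<Rightarrow> 'a \<Rightarrow> 'a set set" where
  "linked a d e = {{d}, {a, e}, {a, d, e}}"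

definition quint :: "'a \<Rightarrow> 'a \<Rightarrow> 'a \<Rightarrow> 'a \<Rightarrow> 'a \<Rightarrow> 'a set set set" where
  "quint a b c d e = {{{a}}, {{a, b}}, {{c}, {d, e}}, linked a d e}"

lemma linked_eq_single: "linked a d e = {A} \<longleftrightarrow> d = a \<and> e = a \<and> A = {a}"
  unfolding linked_def by auto

text \<open>
  The set \<open>{d}\<close> can be confused with \<open>{a, e'}\<close> or \<open>{a, d', e'}\<close> only if it is \<open>{a}\<close>, so two different
  candidates for \<open>d\<close> would both have to be \<open>a\<close>. With \<open>d\<close> known, the same comparison for
  \<open>{a, e}\<close> gives \<open>e\<close>.
\<close>

lemma linked_inject:
  assumes eq: "linked a d e = linked a d' e'"
  shows "d = d' \<and> e = e'"
proof -
  have single: "d = d' \<or> d = a" if "linked a d e = linked a d' e'" for d e d' e'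
  proof -
    have "{d} \<in> linked a d' e'"
      unfolding that[symmetric] by (simp add: linked_def)
    thus ?thesis by (auto simp: linked_def)
  qed
  have d: "d = d'"
    using single[OF eq] single[OF eq[symmetric]] by blast
  have partner: "e = e' \<or> e' = a" if "linked a d e = linked a d e'" for e e'
  proof (cases "e = a")
    case True
    note that = that[unfolded True]
    have "{a, e'} \<in> linked a d a"
      unfolding that by (simp add: linked_def)
    moreover have "{a} \<in> linked a d e'"
      unfolding that[symmetric] by (simp add: linked_def)
    ultimately show ?thesis by (auto simp: linked_def doubleton_eq_iff)
  next
    case False
    have "{a, e} \<in> linked a d e'"
      unfolding that[symmetric] by (simp add: linked_def)
    hence "{a, e} = {d} \<or> {a, e} = {a, e'} \<or> {a, e} = {a, d, e'}"
      by (simp add: linked_def)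
    hence "e' \<in> {a, e}"
      using False by blast
    thus ?thesis by blast
  qed
  have "e = e'"
    using partner[of e e'] partner[of e' e] eq d by auto
  with d show ?thesis by blast
qed

text \<open>
  The only way in which the last member of the code can coincide with a third member
  \<open>{{c'}, {d', e'}}\<close>: it has a third set \<open>{a, d, e}\<close>, and this must not be a new one, so \<open>d\<close>
  is \<open>a\<close> or \<open>e\<close>.
\<close>

lemma linked_eq_pair:
  assumes "linked a d e = {{c'}, {d', e'}}"
  shows "c' = d \<and> d \<in> {a, e} \<and> {d', e'} = {a, e}"
proof -
  have mem: "{d} \<in> {{c'}, {d', e'}}" "{a, e} \<in> {{c'}, {d', e'}}" "{a, d, e} \<in> {{c'}, {d', e'}}"
    unfolding assms[symmetric] by (simp_all add: linked_def)
  have mem': "{c'} \<in> linked a d e" "{d', e'} \<in> linked a d e"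
    unfolding assms by simp_all
  show ?thesis
  proof (cases "{a, e} = {d', e'}")
    case True
    hence "d \<in> {a, e}"
      using mem(3) by blast
    moreover from this have "c' = d"
      using mem'(1) by (auto simp: linked_def)
    ultimately show ?thesis using True by simp
  next
    case False
    hence "a = c'" "e = c'"
      using mem(2) by auto
    moreover have "d = c'"
      using mem(1,3) calculation by auto
    ultimately show ?thesis
      using mem'(2) by (auto simp: linked_def)
  qed
qed

lemma pair_inject_fst:
  assumes "{{c}, {d, e}} = {{c'}, {d, e}}"
  shows "c = c'"
  using assms by (auto simp: doubleton_eq_iff)

text \<open>
  The element \<open>a\<close> is the \<open>t\<close> with \<open>{{t}}\<close> in the code, except that \<open>c = d = e\<close> provides a second one.
  If two codes agree but have different first elements \<open>a\<close> and \<open>a'\<close>, then this happens on both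
  sides, with \<open>c = d = e = a'\<close> and \<open>c' = d' = e' = a\<close>. The only members with more than one
  set are then \<open>{{a'}, {a, a'}}\<close> on one side and \<open>{{a}, {a, a'}}\<close> on the other, and they differ.
\<close>

lemma quint_inject_base:
  assumes eq: "quint a b c d e = quint a' b' c' d' e'"
  shows "a = a'"
proof (rule ccontr)
  assume ne: "a \<noteq> a'"
  have cde: "c = a' \<and> d = a' \<and> e = a'"
    if "quint a b c d e = quint a' b' c' d' e'" "a \<noteq> a'" for a b c d e a' b' c' d' e' :: 'a
  proof -
    have "{{a'}} \<in> quint a b c d e"
      unfolding that(1) by (simp add: quint_def)
    with that(2) show ?thesis
      unfolding quint_def by (auto simp: linked_eq_single eq_commute[of "{_}" "linked _ _ _"])
  qed
  have "linked a d e \<in> quint a' b' c' d' e'"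
    unfolding eq[symmetric] by (simp add: quint_def)
  hence "linked a a' a' \<in> quint a' b' a a a"
    using cde[OF eq ne] cde[OF eq[symmetric]] ne by simp
  with ne show False
    unfolding quint_def linked_def by (auto simp: doubleton_eq_iff)
qed

text \<open>
  Once \<open>a\<close> is fixed, a member of the form \<open>{{a, t}}\<close> with \<open>t \<noteq> a\<close> can only be the second one.
\<close>

lemma quint_inject_second:
  assumes eq: "quint a b c d e = quint a b' c' d' e'"
  shows "b = b'"
proof -
  have "b = b' \<or> b = a" if "quint a b c d e = quint a b' c' d' e'" for a b c d e b' c' d' e' :: 'a
  proof -
    have "{{a, b}} \<in> quint a b' c' d' e'"
      unfolding that[symmetric] by (simp add: quint_def)
    thus ?thesis
      unfolding quint_def by (auto simp: linked_eq_single eq_commute[of "{_}" "linked _ _ _"] doubleton_eq_iff)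
  qed
  from this[OF eq] this[OF eq[symmetric]] show ?thesis by blast
qed

text \<open>
  Suppose that the last members of two equal codes differ. Then each of them is found elsewhere in the
  other code: it has shrunk to \<open>{{a}}\<close> or equals the third member there. Shrinking means
  \<open>d = e = a\<close>, which makes the other one shrink as well. Otherwise both equal third members, and then
  \<open>{a, e} = {d', e'}\<close> and \<open>{a, e'} = {d, e}\<close>, where \<open>d\<close> is \<open>a\<close> or \<open>e\<close> and \<open>d'\<close> is \<open>a\<close> or
  \<open>e'\<close>. This leaves no room for a difference.
\<close>

lemma quint_inject_linked:
  assumes eq: "quint a b c d e = quint a b c' d' e'"
  shows "linked a d e = linked a d' e'"
proof (rule ccontr)
  assume ne: "linked a d e \<noteq> linked a d' e'"
  have l: "linked a d e \<in> quint a b c' d' e'"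
    unfolding eq[symmetric] by (simp add: quint_def)
  have l': "linked a d' e' \<in> quint a b c d e"
    unfolding eq by (simp add: quint_def)
  have single: "linked a d e = {{a}}" if "linked a d e = {{a, b}}" for d e
    using that by (simp add: linked_eq_single)
  have cases: "linked a d e = {{a}} \<or> linked a d e = {{c'}, {d', e'}}"
    using l ne single[of d e] unfolding quint_def insert_iff empty_iff by metis
  have cases': "linked a d' e' = {{a}} \<or> linked a d' e' = {{c}, {d, e}}"
    using l' ne single[of d' e'] unfolding quint_def insert_iff empty_iff by metis
  have degenerate: "linked a d' e' = {{a}}"
    if "linked a d e = {{a}}" "linked a d' e' = {{c}, {d, e}}" for c d e d' e'
  proof -
    have "d = a" "e = a"
      using that(1) by (auto simp: linked_eq_single)
    with linked_eq_pair[OF that(2)] show ?thesis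
      by (auto simp: linked_eq_single)
  qed
  have "linked a d e = {{c'}, {d', e'}} \<and> linked a d' e' = {{c}, {d, e}}"
    using cases cases' ne degenerate by metis
  hence "d = d' \<and> e = e'"
    by (auto dest!: linked_eq_pair simp: doubleton_eq_iff)
  with ne show False by simp
qed

text \<open>
  After \<open>a\<close>, \<open>b\<close>, \<open>d\<close> and \<open>e\<close> only the third member \<open>{{c}, {d, e}}\<close> can vary, and it determines \<open>c\<close>. If the two
  third members differ, both coincide with other members, and then both entries \<open>c\<close> equal \<open>a\<close>.
\<close>

lemma quint_inject:
  assumes eq: "quint a b c d e = quint a' b' c' d' e'"
  shows "a = a' \<and> b = b' \<and> c = c' \<and> d = d' \<and> e = e'"
proof -
  have a: "a' = a"
    using quint_inject_base[OF eq] ..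
  have b: "b' = b"
    using quint_inject_second[OF eq[unfolded a]] ..
  have de: "d' = d" "e' = e"
    using linked_inject[OF quint_inject_linked[OF eq[unfolded a b]]] by auto
  note eq = eq[unfolded a b de]
  have "c = c'"
  proof (cases "{{c}, {d, e}} = {{c'}, {d, e}}")
    case True
    thus ?thesis by (rule pair_inject_fst)
  next
    case False
    \<comment> \<open>A third member that is missing among the third members of the other code must equal one of the
      remaining members, and each of these coincidences puts \<open>c\<close> equal to \<open>a\<close>.\<close>
    have "c = a" if "quint a b c d e = quint a b c' d e" "{{c}, {d, e}} \<noteq> {{c'}, {d, e}}" for c c'
    proof -
      have "{{c}, {d, e}} \<in> quint a b c' d e"
        unfolding that(1)[symmetric] by (simp add: quint_def)
      with that(2) have "{{c}, {d, e}} = {{a}} \<or> {{c}, {d, e}} = {{a, b}} \<or> linked a d e = {{c}, {d, e}}"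
        unfolding quint_def insert_iff empty_iff by metis
      thus ?thesis
        by (auto dest!: linked_eq_pair simp: doubleton_eq_iff)
    qed
    from this[OF eq False] this[OF eq[symmetric] False[symmetric]] show ?thesis by simp
  qed
  with a b de show ?thesis by simp
qed

section \<open>The values\<close>

lemma good_1_1: "good D0 1 1"
proof -
  have "\<exists>f\<in>FF D0 1 1. \<forall>x\<in>tuples D0 1. sets1 (f x) = x ` {1}"
    by (rule FF_1_realize) simp_all
  then obtain f where f: "f \<in> FF D0 1 1" "\<And>x. x \<in> tuples D0 1 \<Longrightarrow> sets1 (f x) = x ` {1}"
    by metis
  show ?thesis
  proof (rule goodI[OF _ _ f(1)])
    fix x y i assume xy: "x \<in> tuples D0 1" "y \<in> tuples D0 1" "f x = f y" and i: "1 \<le> i" "i \<le> (1::nat)"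
    have "x ` {1} = y ` {1}"
      using f(2) xy by metis
    with i show "x i = y i" by simp
  qed simp_all
qed

lemma good_2_2: "good D0 2 2"
proof -
  have "\<exists>f\<in>FF D0 2 2. \<forall>x\<in>tuples D0 2. sets2 (f x) = (`) x ` {{1}, {1, 2}}"
    by (rule FF_2_realize) auto
  then obtain f where f: "f \<in> FF D0 2 2" "\<And>x. x \<in> tuples D0 2 \<Longrightarrow> sets2 (f x) = (`) x ` {{1}, {1, 2}}"
    by metis
  show ?thesis
  proof (rule goodI[OF _ _ f(1)])
    fix x y i assume xy: "x \<in> tuples D0 2" "y \<in> tuples D0 2" "f x = f y" and i: "1 \<le> i" "i \<le> (2::nat)"
    have "(`) x ` {{1}, {1, 2}} = (`) y ` {{1}, {1, 2}}"
      using f(2) xy by metis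
    hence "x 1 = y 1 \<and> x 2 = y 2"
      by (auto simp: doubleton_eq_iff)
    moreover have "i = 1 \<or> i = 2"
      using i by auto
    ultimately show "x i = y i" by blast
  qed simp_all
qed

lemma good_3:
  assumes "3 \<le> k" "k \<le> 5"
  shows "good D0 k 3"
proof -
  \<comment> \<open>The pattern lives over indices; for \<open>k < 5\<close> the minimum repeats the last coordinate.\<close>
  let ?G = "quint 1 2 3 (min 4 k) (min 5 k)"
  have "\<exists>f\<in>FF D0 k 3. \<forall>x\<in>tuples D0 k. sets3 (f x) = (`) ((`) x) ` ?G"
    using assms by (intro FF_3_realize) (auto simp: quint_def linked_def)
  moreover have "(`) ((`) x) ` ?G = quint (x 1) (x 2) (x 3) (x (min 4 k)) (x (min 5 k))" for x :: "nat \<Rightarrow> 'a"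
    by (simp add: quint_def linked_def)
  ultimately obtain f where f: "f \<in> FF D0 k 3"
      "\<And>x. x \<in> tuples D0 k \<Longrightarrow> sets3 (f x) = quint (x 1) (x 2) (x 3) (x (min 4 k)) (x (min 5 k))"
    by metis
  show ?thesis
  proof (rule goodI[OF _ _ f(1)])
    fix x y i assume xy: "x \<in> tuples D0 k" "y \<in> tuples D0 k" "f x = f y" and i: "1 \<le> i" "i \<le> k"
    have "x 1 = y 1 \<and> x 2 = y 2 \<and> x 3 = y 3 \<and> x (min 4 k) = y (min 4 k) \<and> x (min 5 k) = y (min 5 k)"
      using f(2) xy by (intro quint_inject) metis
    moreover have "i = 1 \<or> i = 2 \<or> i = 3 \<or> i = min 4 k \<or> i = min 5 k"
      using i assms(2) by auto
    ultimately show "x i = y i" by blast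
  qed (use assms in auto)
qed

theorem theorem4p1:
  fixes D0 :: "'a set"
  assumes "infinite D0"
  shows "mu D0 1 = 1 \<and> mu D0 2 = 2 \<and> mu D0 3 = 3 \<and> mu D0 4 = 3 \<and> mu D0 5 = 3"
proof -
  have pos: "1 \<le> n" if "good D0 k n" for k n
    using that by (simp add: good_def)
  have "mu D0 1 = 1"
    unfolding mu_def by (rule Least_equality) (use good_1_1 pos in blast)+
  moreover have "mu D0 2 = 2"
    unfolding mu_def
  proof (rule Least_equality, rule good_2_2)
    fix n assume n: "good D0 2 n"
    hence "n \<noteq> 1"
      using good_two_atoms_bounds(1)[OF assms, of 2] by auto
    with pos[OF n] show "2 \<le> n" by simp
  qed
  moreover have "mu D0 k = 3" if k: "3 \<le> k" "k \<le> 5" for k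
    unfolding mu_def
  proof (rule Least_equality, rule good_3[OF k])
    fix n assume n: "good D0 k n"
    have "2 ^ 3 \<le> (2 ^ k :: nat)"
      using k(1) by (intro power_increasing) auto
    hence "n \<noteq> 1 \<and> n \<noteq> 2"
      using good_two_atoms_bounds[OF assms, of k] n by auto
    with pos[OF n] show "3 \<le> n" by simp
  qed
  ultimately show ?thesis by simp
qed

end
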